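(* Let $n\ge 4$ and $m\ge 1$ be integers, let $G=\{-1,+1\}^m$ with identity element $e$, and let $\Sigma=(K_n,\sigma,G)$ be a multisigned complete graph. Then the following hold. (a) Let $g$ be a fixed non-identity element of $G$. All Hamiltonian cycles in $\Sigma$ have the same multisign $g$ if and only if all triangles in $\Sigma$ have multisign $g$ and $n$ is odd. Similarly, all Hamiltonian cycles in $\Sigma$ have multisign $e$ if and only if either all triangles in $\Sigma$ have the same non-identity multisign and $n$ is even, or all triangles in $\Sigma$ have multisign $e$. (b) $\Sigma$ contains at least two Hamiltonian cycles with different multisigns if and only if it contains at least two triangles with different multisigns.
   Context: $G=\{-1,+1\}^m$ is a group under componentwise multiplication, with identity $e=(+1,\dots,+1)$. A multisigned complete graph $\Sigma=(K_n,\sigma,G)$ consists of the complete graph $K_n$ on $n$ vertices together with a function $\sigma$ from the set of (undirected) edges of $K_n$ to $G$. The multisign $\sigma(P)$ of a cycle $P$ is the product in $G$ of the values of $\sigma$ on all edges of $P$. A triangle is a cycle of length 3. A Hamiltonian cycle is a cycle passing through every vertex exactly once. *)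

theory Defs
  imports
    "HOL-Algebra.FiniteProduct"
    "HOL-Algebra.Product_Groups"
    "HOL-Algebra.Sym_Groups"
    "HOL-Library.Ramsey"
begin

text \<open>\<^const>\<open>sign_img\<close> is the library's multiplicative group on \<open>{-1, 1} :: int set\<close>.\<close>

definition multisign_group :: "nat \<Rightarrow> (nat \<Rightarrow> int) monoid"
  where "multisign_group m = product_group {1..m} (\<lambda>_. sign_img)"

lemma comm_group_multisign_group: "comm_group (multisign_group m)"
proof -
  have "group (multisign_group m)"
    by (simp add: multisign_group_def sign_img_is_group)
  then show ?thesis
    by (rule group.group_comm_groupI)
      (auto simp: multisign_group_def sign_img_def mult.commute)
qed

text \<open>The edges of the complete graph on \<open>V\<close> are the two-element subsets of \<open>V\<close>.\<close>

definition complete_edges :: "'v set \<Rightarrow> 'v set set"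
  where "complete_edges V = nsets V 2"

text \<open>A multisigned complete graph is a vertex set with an edge labelling; the values of \<open>\<sigma>\<close>
  outside the edge set are irrelevant.\<close>

definition multisigned_complete_graph ::
    "'v set \<Rightarrow> ('v set \<Rightarrow> 'g) \<Rightarrow> ('g, 'b) monoid_scheme \<Rightarrow> bool"
  where "multisigned_complete_graph V \<sigma> G \<longleftrightarrow>
    finite V \<and> \<sigma> \<in> complete_edges V \<rightarrow> carrier G"

text \<open>A cycle is given by listing its vertices in cyclic order, so that one cycle is represented
  by several lists (its rotations and reversals), all having the same edge set.\<close>

definition cycle_edges :: "'v list \<Rightarrow> 'v set set"
  where "cycle_edges xs = {{xs ! i, xs ! (Suc i mod length xs)} | i. i < length xs}"

definition graph_cycle :: "'v set \<Rightarrow> 'v set set \<Rightarrow> 'v list \<Rightarrow> bool"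
  where "graph_cycle V E xs \<longleftrightarrow>
    3 \<le> length xs \<and> distinct xs \<and> set xs \<subseteq> V \<and> cycle_edges xs \<subseteq> E"

definition graph_triangle :: "'v set \<Rightarrow> 'v set set \<Rightarrow> 'v list \<Rightarrow> bool"
  where "graph_triangle V E xs \<longleftrightarrow> graph_cycle V E xs \<and> length xs = 3"

definition hamiltonian_cycle :: "'v set \<Rightarrow> 'v set set \<Rightarrow> 'v list \<Rightarrow> bool"
  where "hamiltonian_cycle V E xs \<longleftrightarrow> graph_cycle V E xs \<and> set xs = V"

definition multisign :: "('g, 'b) monoid_scheme \<Rightarrow> ('v set \<Rightarrow> 'g) \<Rightarrow> 'v list \<Rightarrow> 'g"
  where "multisign G \<sigma> xs = (\<Otimes>\<^bsub>G\<^esub>d\<in>cycle_edges xs. \<sigma> d)"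

end

theory Submission
  imports Defs
begin

text \<open>
  Every element of the abelian group \<open>{-1,+1}\<^sup>m\<close> is its own inverse. The argument rests on this
  alone and is carried out in an arbitrary abelian group of exponent two.

  Suppose all triangles have multisign \<open>h\<close>. Cutting a cycle of length \<open>k\<close> into triangles by chords
  from one vertex uses every chord twice, so the chords cancel, and the cycle has multisign
  \<open>h\<^bsup>k-2\<^esup> = h\<^bsup>k\<^esup>\<close> (\<open>cycle_sign_of_constant_triangles\<close>). Thus all Hamiltonian cycles have multisign
  \<open>h\<^bsup>n\<^esup>\<close>, which is \<open>h\<close> for odd \<open>n\<close> and the identity for even \<open>n\<close>.

  Conversely, suppose all Hamiltonian cycles have the same multisign. Exchanging two consecutive
  vertices of the Hamiltonian cycle \<open>a b c d \<dots>\<close> gives \<open>a c b d \<dots>\<close>, and comparing the two yields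
  \<open>\<sigma>(ab) \<sigma>(cd) = \<sigma>(ac) \<sigma>(bd)\<close>; in exponent two this says that the triangles \<open>abc\<close> and \<open>dbc\<close> have the
  same multisign. Hence a triangle keeps its multisign when one vertex is replaced, and so all
  triangles agree (\<open>constant_triangles_of_constant_hamiltonian\<close>).

  So constancy on triangles and constancy on Hamiltonian cycles are equivalent, which is (b). If both
  hold, the common values are \<open>h\<close> and \<open>h\<^bsup>n\<^esup>\<close>, and (a) lists when \<open>h\<^bsup>n\<^esup>\<close> is a given element.
\<close>

section \<open>Exchanging elements in subsets of fixed size\<close>

text \<open>The \<open>k\<close>-subsets of \<open>V\<close> are connected under exchange of one element: each exchange can bring
  \<open>A\<close> one element closer to \<open>B\<close>.\<close>

lemma invariant_under_exchange_imp_constant: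
  assumes exchange: "\<And>C a b. \<lbrakk>insert a C \<subseteq> V; insert b C \<subseteq> V; a \<notin> C; b \<notin> C; card (insert a C) = k\<rbrakk>
      \<Longrightarrow> f (insert a C) = f (insert b C)"
    and "finite V" and "A \<subseteq> V" and "B \<subseteq> V" and "card A = k" and "card B = k"
  shows "f A = f B"
  using assms(3,5)
proof (induction "card (A - B)" arbitrary: A)
  case 0
  have "finite A" "finite B"
    using 0 \<open>finite V\<close> \<open>B \<subseteq> V\<close> by (auto intro: finite_subset)
  then have "A \<subseteq> B"
    using 0 by auto
  then show ?case
    using 0 \<open>finite B\<close> \<open>card B = k\<close> by (metis card_subset_eq)
next
  case (Suc j)
  have fin: "finite A" "finite B"
    using Suc.prems \<open>finite V\<close> \<open>B \<subseteq> V\<close> by (auto intro: finite_subset)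
  obtain a where a: "a \<in> A" "a \<notin> B"
    using Suc.hyps(2) by (metis DiffE card.empty equals0I nat.distinct(1))
  have "\<not> B \<subseteq> A"
    using fin a Suc.prems \<open>card B = k\<close> by (metis card_subset_eq)
  then obtain b where b: "b \<in> B" "b \<notin> A"
    by blast
  let ?C = "A - {a}"
  have A: "A = insert a ?C"
    using a by blast
  have "card (insert b ?C) = k"
    using fin b card_Suc_Diff1[OF fin(1) a(1)] Suc.prems by simp
  moreover have "insert b ?C - B = (A - B) - {a}"
    using b by blast
  then have "j = card (insert b ?C - B)"
    using Suc.hyps(2) a fin by simp
  moreover have "insert b ?C \<subseteq> V"
    using b Suc.prems \<open>B \<subseteq> V\<close> by blast
  ultimately have "f (insert b ?C) = f B"
    using Suc.hyps(1) by blast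
  moreover have "f (insert a ?C) = f (insert b ?C)"
    using A b \<open>insert b ?C \<subseteq> V\<close> Suc.prems by (intro exchange) auto
  ultimately show ?case
    using A by simp
qed

section \<open>Edge sets of paths and cycles\<close>

fun path_edges :: "'v list \<Rightarrow> 'v set set"
  where
    "path_edges (x # y # xs) = insert {x, y} (path_edges (y # xs))"
  | "path_edges _ = {}"

lemma finite_path_edges: "finite (path_edges xs)"
  by (induction xs rule: path_edges.induct) auto

lemma path_edges_conv_nth: "path_edges xs = {{xs ! i, xs ! Suc i} | i. Suc i < length xs}"
proof (induction xs rule: path_edges.induct)
  case (1 x y xs)
  have "{{(x # y # xs) ! i, (x # y # xs) ! Suc i} | i. Suc i < length (x # y # xs)}
      = insert {x, y} {{(y # xs) ! i, (y # xs) ! Suc i} | i. Suc i < length (y # xs)}"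
    (is "?L = ?R")
  proof
    show "?L \<subseteq> ?R"
    proof
      fix d assume "d \<in> ?L"
      then obtain i where "Suc i < length (x # y # xs)"
        and "d = {(x # y # xs) ! i, (x # y # xs) ! Suc i}"
        by blast
      then show "d \<in> ?R"
        by (cases i) auto
    qed
    have "{x, y} \<in> ?L"
      by (auto intro: exI[of _ 0])
    moreover have "{(y # xs) ! i, (y # xs) ! Suc i} \<in> ?L" if "Suc i < length (y # xs)" for i
      using that by (auto intro: exI[of _ "Suc i"])
    ultimately show "?R \<subseteq> ?L"
      by blast
  qed
  then show ?case
    using 1 by simp
qed auto

lemma path_edges_subset: "d \<in> path_edges xs \<Longrightarrow> d \<subseteq> set xs"
  by (induction xs rule: path_edges.induct) auto

lemma cycle_edges_eq_insert_path_edges: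
  assumes "xs \<noteq> []"
  shows "cycle_edges xs = insert {last xs, hd xs} (path_edges xs)"
proof
  show "cycle_edges xs \<subseteq> insert {last xs, hd xs} (path_edges xs)"
  proof
    fix d assume "d \<in> cycle_edges xs"
    then obtain i where i: "i < length xs" and d: "d = {xs ! i, xs ! (Suc i mod length xs)}"
      unfolding cycle_edges_def by blast
    show "d \<in> insert {last xs, hd xs} (path_edges xs)"
    proof (cases "Suc i < length xs")
      case True
      then show ?thesis
        using d by (auto simp: path_edges_conv_nth)
    next
      case False
      then have "Suc i = length xs"
        using i by simp
      then show ?thesis
        using d assms by (metis diff_Suc_1 hd_conv_nth insertI1 last_conv_nth mod_self)
    qed
  qed
  have "{last xs, hd xs} \<in> cycle_edges xs"
    using assms unfolding cycle_edges_def
    by (auto simp: last_conv_nth hd_conv_nth intro!: exI[of _ "length xs - 1"])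
  moreover have "path_edges xs \<subseteq> cycle_edges xs"
    unfolding path_edges_conv_nth cycle_edges_def by force
  ultimately show "insert {last xs, hd xs} (path_edges xs) \<subseteq> cycle_edges xs"
    by blast
qed

text \<open>Length three is needed here: a path with two vertices already contains its closing edge.\<close>

lemma closing_edge_notin_path_edges:
  assumes "distinct xs" and "3 \<le> length xs"
  shows "{last xs, hd xs} \<notin> path_edges xs"
proof -
  obtain x y z zs where xs: "xs = x # y # z # zs"
    using assms(2) by (auto simp: numeral_3_eq_3 Suc_le_length_iff)
  have "last (z # zs) \<noteq> y" and "last (z # zs) \<in> set (z # zs)"
    using assms(1) last_in_set[of "z # zs"] unfolding xs by (auto simp del: last.simps)
  then show ?thesis
    using assms(1) path_edges_subset[of _ "y # z # zs"] unfolding xs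
    by (fastforce simp: doubleton_eq_iff)
qed

lemma doubleton_in_complete_edges_iff:
  "{x, y} \<in> complete_edges V \<longleftrightarrow> x \<in> V \<and> y \<in> V \<and> x \<noteq> y"
  by (auto simp: complete_edges_def nsets_def card_2_iff doubleton_eq_iff)

lemma path_edges_subset_complete_edges:
  "distinct xs \<Longrightarrow> set xs \<subseteq> V \<Longrightarrow> path_edges xs \<subseteq> complete_edges V"
  by (induction xs rule: path_edges.induct) (auto simp: doubleton_in_complete_edges_iff)

lemma graph_cycle_complete_iff:
  "graph_cycle V (complete_edges V) xs \<longleftrightarrow> 3 \<le> length xs \<and> distinct xs \<and> set xs \<subseteq> V"
proof -
  have "cycle_edges xs \<subseteq> complete_edges V"
    if len: "3 \<le> length xs" and "distinct xs" and sub: "set xs \<subseteq> V"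
  proof -
    have ne: "xs \<noteq> []"
      using len by auto
    have "hd xs \<noteq> last xs"
      using len \<open>distinct xs\<close> by (cases xs) (auto split: if_splits)
    moreover have "hd xs \<in> V" "last xs \<in> V"
      using ne sub by auto
    ultimately show ?thesis
      using path_edges_subset_complete_edges[OF \<open>distinct xs\<close> sub]
      by (simp add: cycle_edges_eq_insert_path_edges[OF ne] doubleton_in_complete_edges_iff)
  qed
  then show ?thesis
    unfolding graph_cycle_def by blast
qed

lemma graph_triangle_complete_iff:
  "graph_triangle V (complete_edges V) T \<longleftrightarrow>
    (\<exists>a b c. T = [a, b, c] \<and> distinct [a, b, c] \<and> {a, b, c} \<subseteq> V)"
  unfolding graph_triangle_def graph_cycle_complete_iff
  by (auto simp: numeral_3_eq_3 length_Suc_conv)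

lemma hamiltonian_cycle_complete_iff:
  "hamiltonian_cycle V (complete_edges V) C \<longleftrightarrow> 3 \<le> length C \<and> distinct C \<and> set C = V"
  unfolding hamiltonian_cycle_def graph_cycle_complete_iff by auto

lemma cycle_edges_triangle: "cycle_edges [a, b, c] = {{c, a}, {a, b}, {b, c}}"
  by (simp add: cycle_edges_eq_insert_path_edges)

section \<open>Multisigns in an abelian group of exponent two\<close>

locale multisigned_complete = comm_group G for G (structure) +
  fixes V :: "'v set" and \<sigma> :: "'v set \<Rightarrow> 'a"
  assumes self_inverse: "x \<in> carrier G \<Longrightarrow> x \<otimes> x = \<one>"
    and graph: "multisigned_complete_graph V \<sigma> G"
begin

abbreviation is_triangle :: "'v list \<Rightarrow> bool"
  where "is_triangle \<equiv> graph_triangle V (complete_edges V)"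

abbreviation is_hamiltonian :: "'v list \<Rightarrow> bool"
  where "is_hamiltonian \<equiv> hamiltonian_cycle V (complete_edges V)"

abbreviation path_sign :: "'v list \<Rightarrow> 'a"
  where "path_sign xs \<equiv> (\<Otimes>d\<in>path_edges xs. \<sigma> d)"

lemma finite_V: "finite V"
  using graph by (simp add: multisigned_complete_graph_def)

lemma sign_closed: "d \<in> complete_edges V \<Longrightarrow> \<sigma> d \<in> carrier G"
  using graph by (auto simp: multisigned_complete_graph_def)

lemma edge_sign_closed: "\<lbrakk>x \<in> V; y \<in> V; x \<noteq> y\<rbrakk> \<Longrightarrow> \<sigma> {x, y} \<in> carrier G"
  by (simp add: sign_closed doubleton_in_complete_edges_iff)

lemma self_cancel: "\<lbrakk>x \<in> carrier G; y \<in> carrier G\<rbrakk> \<Longrightarrow> x \<otimes> (x \<otimes> y) = y"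
  by (simp add: m_assoc[symmetric] self_inverse)

lemma pow_parity: "h \<in> carrier G \<Longrightarrow> h [^] (k::nat) = (if even k then \<one> else h)"
  by (induction k) (auto simp: self_inverse)

lemma path_sign_closed: "distinct xs \<Longrightarrow> set xs \<subseteq> V \<Longrightarrow> path_sign xs \<in> carrier G"
  using path_edges_subset_complete_edges[of xs V] by (auto intro!: finprod_closed sign_closed)

lemma path_sign_Cons:
  assumes "distinct (x # y # xs)" and "set (x # y # xs) \<subseteq> V"
  shows "path_sign (x # y # xs) = \<sigma> {x, y} \<otimes> path_sign (y # xs)"
proof -
  have "{x, y} \<notin> path_edges (y # xs)"
    using path_edges_subset[of "{x, y}" "y # xs"] assms(1) by auto
  moreover have "\<sigma> \<in> path_edges (y # xs) \<rightarrow> carrier G"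
    using path_edges_subset_complete_edges[of "y # xs" V] assms by (auto intro!: sign_closed)
  ultimately show ?thesis
    using assms by (simp add: finite_path_edges edge_sign_closed)
qed

lemma multisign_eq_path_sign:
  assumes "distinct xs" and "set xs \<subseteq> V" and "3 \<le> length xs"
  shows "multisign G \<sigma> xs = \<sigma> {last xs, hd xs} \<otimes> path_sign xs"
proof -
  have "xs \<noteq> []"
    using assms(3) by auto
  moreover have "cycle_edges xs \<subseteq> complete_edges V"
    using assms graph_cycle_complete_iff[of V xs] by (simp add: graph_cycle_def)
  ultimately show ?thesis
    using closing_edge_notin_path_edges[OF assms(1,3)]
    by (auto simp: multisign_def cycle_edges_eq_insert_path_edges finite_path_edges
        intro!: finprod_insert sign_closed)
qed

lemma multisign_triangle:
  assumes "distinct [a, b, c]" and "{a, b, c} \<subseteq> V"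
  shows "multisign G \<sigma> [a, b, c] = \<sigma> {c, a} \<otimes> (\<sigma> {a, b} \<otimes> \<sigma> {b, c})"
proof -
  have "path_sign [c] = \<one>"
    by simp
  then show ?thesis
    using assms
    by (simp add: multisign_eq_path_sign path_sign_Cons edge_sign_closed del: path_edges.simps(1))
qed

section \<open>Cycles when all triangles have the same multisign\<close>

text \<open>
  The triangulation argument, one triangle at a time: putting a vertex \<open>x\<close> in front of a path
  replaces the chord joining the ends of the old path by the two other sides of a triangle. The
  claim includes the degenerate case of two vertices, where the closed walk runs along one edge
  twice; there \<open>h \<otimes> h = \<one>\<close> starts the induction.
\<close>

lemma closed_path_sign_of_constant_triangles:
  assumes h: "h \<in> carrier G" and tri: "\<And>T. is_triangle T \<Longrightarrow> multisign G \<sigma> T = h"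
  shows "\<lbrakk>distinct xs; set xs \<subseteq> V; 2 \<le> length xs\<rbrakk>
    \<Longrightarrow> \<sigma> {last xs, hd xs} \<otimes> path_sign xs = h [^] length xs"
proof (induction xs rule: path_edges.induct)
  case (1 x y xs)
  show ?case
  proof (cases xs)
    case Nil
    have "path_sign [y] = \<one>"
      by simp
    then show ?thesis
      using 1 h Nil
      by (simp add: path_sign_Cons edge_sign_closed insert_commute self_inverse pow_parity
          del: path_edges.simps(1))
  next
    case (Cons z zs)
    define l where "l = last (y # xs)"
    have l: "l \<in> set xs" "last (x # y # xs) = l"
      using Cons by (auto simp: l_def)
    then have dist: "distinct [x, y, l]" and sub: "{x, y, l} \<subseteq> V"
      using 1(2,3) by auto
    have IH: "\<sigma> {l, y} \<otimes> path_sign (y # xs) = h [^] length (y # xs)"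
      using 1 Cons by (simp add: l_def del: path_edges.simps)
    have T: "h = \<sigma> {l, x} \<otimes> (\<sigma> {x, y} \<otimes> \<sigma> {y, l})"
      using tri[of "[x, y, l]"] multisign_triangle[OF dist sub] dist sub
      by (auto simp: graph_triangle_complete_iff)
    have closed: "\<sigma> {l, x} \<in> carrier G" "\<sigma> {x, y} \<in> carrier G" "\<sigma> {l, y} \<in> carrier G"
      "path_sign (y # xs) \<in> carrier G"
      using dist sub 1(2,3) by (auto intro!: edge_sign_closed path_sign_closed)
    have "h [^] length (x # y # xs) = h \<otimes> (\<sigma> {l, y} \<otimes> path_sign (y # xs))"
      using h IH by (simp add: m_comm)
    also have "\<dots> = \<sigma> {l, x} \<otimes> (\<sigma> {x, y} \<otimes> (\<sigma> {l, y} \<otimes> (\<sigma> {l, y} \<otimes> path_sign (y # xs))))"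
      using closed by (subst T) (simp add: m_assoc insert_commute)
    also have "\<dots> = \<sigma> {l, x} \<otimes> path_sign (x # y # xs)"
      using closed path_sign_Cons[OF 1(2,3)] by (simp add: self_cancel del: path_edges.simps)
    finally show ?thesis
      using l(2) by (simp del: path_edges.simps last.simps)
  qed
qed auto

lemma cycle_sign_of_constant_triangles:
  assumes "h \<in> carrier G" and "\<And>T. is_triangle T \<Longrightarrow> multisign G \<sigma> T = h"
    and "graph_cycle V (complete_edges V) C"
  shows "multisign G \<sigma> C = h [^] length C"
  using assms(3) closed_path_sign_of_constant_triangles[OF assms(1,2), of C]
  by (simp add: graph_cycle_complete_iff multisign_eq_path_sign)

lemma hamiltonian_sign_of_constant_triangles:
  assumes "h \<in> carrier G" and "\<And>T. is_triangle T \<Longrightarrow> multisign G \<sigma> T = h" and "is_hamiltonian C"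
  shows "multisign G \<sigma> C = h [^] card V"
proof -
  have "length C = card V"
    using assms(3) by (auto simp: hamiltonian_cycle_complete_iff distinct_card)
  then show ?thesis
    using cycle_sign_of_constant_triangles[OF assms(1,2)] assms(3)
    by (auto simp: hamiltonian_cycle_def)
qed

section \<open>Triangles when all Hamiltonian cycles have the same multisign\<close>

text \<open>
  With four vertices \<open>a b c d\<close> at the start of a Hamiltonian cycle, exchanging \<open>b\<close> and \<open>c\<close> replaces
  the edges \<open>ab\<close> and \<open>cd\<close> by \<open>ac\<close> and \<open>bd\<close> and leaves all others in place.
\<close>

lemma constant_hamiltonian_imp_quadrangle:
  assumes ham: "\<And>C. is_hamiltonian C \<Longrightarrow> multisign G \<sigma> C = g"
    and dist: "distinct [a, b, c, d]" and sub: "{a, b, c, d} \<subseteq> V"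
  shows "\<sigma> {a, b} \<otimes> \<sigma> {c, d} = \<sigma> {a, c} \<otimes> \<sigma> {b, d}"
proof -
  obtain r where r: "set r = V - {a, b, c, d}" "distinct r"
    using finite_V finite_distinct_list[of "V - {a, b, c, d}"] by auto
  define l where "l = last (d # r)"
  have l: "l \<in> set (d # r)"
    unfolding l_def by (rule last_in_set) simp
  then have l_in: "l \<in> V" "l \<noteq> a"
    using r dist sub by auto
  let ?P = "path_sign (d # r)"
  have sign: "multisign G \<sigma> (a # x # y # d # r)
      = \<sigma> {l, a} \<otimes> (\<sigma> {a, x} \<otimes> (\<sigma> {x, y} \<otimes> (\<sigma> {y, d} \<otimes> ?P)))"
    and hamxy: "is_hamiltonian (a # x # y # d # r)"
    if "{x, y} = {b, c}" for x y
  proof -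
    have xy: "x = b \<and> y = c \<or> x = c \<and> y = b"
      using that by (auto simp: doubleton_eq_iff)
    then have dr: "distinct (a # x # y # d # r)" and sr: "set (a # x # y # d # r) = V"
      using r dist sub by auto
    then show "is_hamiltonian (a # x # y # d # r)"
      by (simp add: hamiltonian_cycle_complete_iff)
    have "last (a # x # y # d # r) = l"
      by (simp add: l_def)
    moreover have "path_sign (a # x # y # d # r)
        = \<sigma> {a, x} \<otimes> (\<sigma> {x, y} \<otimes> (\<sigma> {y, d} \<otimes> ?P))"
      using dr sr path_sign_Cons[of a x "y # d # r"] path_sign_Cons[of x y "d # r"]
        path_sign_Cons[of y d r]
      by (simp del: path_edges.simps) (metis insert_subset subset_insertI order_refl)
    ultimately show "multisign G \<sigma> (a # x # y # d # r)
        = \<sigma> {l, a} \<otimes> (\<sigma> {a, x} \<otimes> (\<sigma> {x, y} \<otimes> (\<sigma> {y, d} \<otimes> ?P)))"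
      using multisign_eq_path_sign[OF dr equalityD1[OF sr]]
      by (simp del: path_edges.simps last.simps)
  qed
  have closed: "\<sigma> {l, a} \<in> carrier G" "\<sigma> {a, b} \<in> carrier G" "\<sigma> {a, c} \<in> carrier G"
    "\<sigma> {b, c} \<in> carrier G" "\<sigma> {c, d} \<in> carrier G" "\<sigma> {b, d} \<in> carrier G"
    using dist sub l_in by (simp_all add: edge_sign_closed)
  have P_closed: "?P \<in> carrier G"
    using r sub by (intro path_sign_closed) auto
  let ?R = "\<sigma> {l, a} \<otimes> (\<sigma> {b, c} \<otimes> ?P)"
  have "(\<sigma> {a, b} \<otimes> \<sigma> {c, d}) \<otimes> ?R = multisign G \<sigma> (a # b # c # d # r)"
    using closed P_closed by (simp add: sign m_ac del: path_edges.simps)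
  also have "\<dots> = multisign G \<sigma> (a # c # b # d # r)"
    using ham[OF hamxy[OF refl]] ham[OF hamxy[OF insert_commute]] by simp
  also have "\<dots> = (\<sigma> {a, c} \<otimes> \<sigma> {b, d}) \<otimes> ?R"
    using closed P_closed sign[of c b] by (simp add: m_ac insert_commute del: path_edges.simps)
  finally show ?thesis
    using closed P_closed by simp
qed

text \<open>
  The multisign of a triangle depends only on its three vertices, since every pair of them is an
  edge; so the exchange lemma applies to the product over all pairs in a three-element set.
\<close>

lemma constant_triangles_of_constant_hamiltonian:
  assumes ham: "\<And>C. is_hamiltonian C \<Longrightarrow> multisign G \<sigma> C = g"
    and "is_triangle S" and "is_triangle T"
  shows "multisign G \<sigma> S = multisign G \<sigma> T"
proof -
  define f where "f A = (\<Otimes>d\<in>nsets A 2. \<sigma> d)" for A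
  have f_triangle: "multisign G \<sigma> [a, b, c] = f {a, b, c}"
    if "distinct [a, b, c]" for a b c
  proof -
    have "cycle_edges [a, b, c] = nsets {a, b, c} 2"
      using that by (auto simp: cycle_edges_triangle nsets_2_eq insert_commute)
    then show ?thesis
      by (simp add: multisign_def f_def)
  qed
  have f_const: "f A = f B" if "A \<subseteq> V" "B \<subseteq> V" "card A = 3" "card B = 3" for A B
  proof (rule invariant_under_exchange_imp_constant[OF _ finite_V that])
    fix C a d
    assume sub: "insert a C \<subseteq> V" "insert d C \<subseteq> V" and notin: "a \<notin> C" "d \<notin> C"
      and card: "card (insert a C) = 3"
    have "finite C"
      using sub finite_V by (auto intro: finite_subset)
    then have "card C = 2"
      using card notin by simp
    then obtain b c where C: "C = {b, c}" "b \<noteq> c"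
      by (auto simp: card_2_iff)
    show "f (insert a C) = f (insert d C)"
    proof (cases "a = d")
      case False
      then have dist: "distinct [a, b, c, d]" and sub4: "{a, b, c, d} \<subseteq> V"
        using C notin sub by auto
      have closed: "\<sigma> {a, b} \<in> carrier G" "\<sigma> {a, c} \<in> carrier G" "\<sigma> {b, c} \<in> carrier G"
        "\<sigma> {c, d} \<in> carrier G" "\<sigma> {b, d} \<in> carrier G"
        using dist sub4 by (auto intro!: edge_sign_closed)
      have quad: "\<sigma> {a, b} \<otimes> \<sigma> {c, d} = \<sigma> {a, c} \<otimes> \<sigma> {b, d}"
        by (rule constant_hamiltonian_imp_quadrangle[OF ham dist sub4])
      \<comment> \<open>Multiply the quadrangle relation by \<open>\<sigma>(ac) \<sigma>(cd)\<close> and cancel the squares.\<close>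
      have "\<sigma> {a, b} \<otimes> \<sigma> {a, c} = \<sigma> {a, c} \<otimes> (\<sigma> {c, d} \<otimes> (\<sigma> {a, b} \<otimes> \<sigma> {c, d}))"
        using closed by (simp add: m_ac self_inverse self_cancel)
      also have "\<dots> = \<sigma> {b, d} \<otimes> \<sigma> {c, d}"
        unfolding quad using closed by (simp add: m_ac self_inverse self_cancel)
      finally have swap: "\<sigma> {a, b} \<otimes> \<sigma> {a, c} = \<sigma> {b, d} \<otimes> \<sigma> {c, d}" .
      have "f {a, b, c} = (\<sigma> {a, b} \<otimes> \<sigma> {a, c}) \<otimes> \<sigma> {b, c}"
        using f_triangle[of a b c] multisign_triangle[of a b c] dist sub4 closed
        by (simp add: insert_commute m_ac)
      also have "\<dots> = f {d, b, c}"
        unfolding swap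
        using f_triangle[of d b c] multisign_triangle[of d b c] dist sub4 closed
        by (auto simp add: insert_commute m_ac)
      finally show ?thesis
        by (simp add: C)
    qed simp
  qed
  have "multisign G \<sigma> U = f (set U) \<and> set U \<subseteq> V \<and> card (set U) = 3" if "is_triangle U" for U
    using that f_triangle by (auto simp: graph_triangle_complete_iff)
  then show ?thesis
    using f_const assms(2,3) by metis
qed

section \<open>Triangles and Hamiltonian cycles together\<close>

lemma ex_hamiltonian:
  assumes "3 \<le> card V"
  shows "\<exists>C. is_hamiltonian C"
proof -
  obtain C where "set C = V" "distinct C"
    using finite_distinct_list[OF finite_V] by blast
  then show ?thesis
    using assms distinct_card[of C] by (auto simp: hamiltonian_cycle_complete_iff)
qed

lemma ex_triangle:
  assumes "3 \<le> card V"
  shows "\<exists>T. is_triangle T"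
proof -
  obtain A where A: "A \<subseteq> V" "card A = 3"
    using obtain_subset_with_card_n[OF assms] by blast
  then obtain a b c where "A = {a, b, c}" "distinct [a, b, c]"
    by (auto simp: card_3_iff)
  then show ?thesis
    using A by (auto simp: graph_triangle_complete_iff)
qed

text \<open>
  Both parts of the theorem are read off from the following two cases: either the multisign is
  constant on triangles and on Hamiltonian cycles, with values \<open>h\<close> and \<open>h\<^bsup>n\<^esup>\<close>, or on neither.
\<close>

lemma triangle_hamiltonian_dichotomy:
  assumes "3 \<le> card V"
  obtains h where "h \<in> carrier G" "\<And>T. is_triangle T \<Longrightarrow> multisign G \<sigma> T = h"
      "\<And>C. is_hamiltonian C \<Longrightarrow> multisign G \<sigma> C = h [^] card V"
    | S T C D where "is_triangle S" "is_triangle T" "multisign G \<sigma> S \<noteq> multisign G \<sigma> T"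
      "is_hamiltonian C" "is_hamiltonian D" "multisign G \<sigma> C \<noteq> multisign G \<sigma> D"
proof (cases "\<forall>S T. is_triangle S \<longrightarrow> is_triangle T \<longrightarrow> multisign G \<sigma> S = multisign G \<sigma> T")
  case True
  obtain T where T: "is_triangle T"
    using ex_triangle[OF assms] by blast
  have "multisign G \<sigma> T \<in> carrier G"
    using T by (auto simp: graph_triangle_complete_iff multisign_triangle edge_sign_closed)
  then show ?thesis
    using that(1) T True hamiltonian_sign_of_constant_triangles by metis
next
  case False
  obtain C where "is_hamiltonian C"
    using ex_hamiltonian[OF assms] by blast
  then show ?thesis
    using that(2) False constant_triangles_of_constant_hamiltonian by metis
qed

end

section \<open>The group of multisigns\<close>

lemma multisign_group_self_inverse:
  assumes "x \<in> carrier (multisign_group m)"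
  shows "x \<otimes>\<^bsub>multisign_group m\<^esub> x = \<one>\<^bsub>multisign_group m\<^esub>"
proof -
  have "x i * x i = 1" if "i \<in> {1..m}" for i
  proof -
    have "x i \<in> {- 1, 1}"
      using PiE_mem[OF assms[unfolded multisign_group_def carrier_product_group] that]
      by (simp add: sign_img_def insert_commute)
    then show ?thesis
      by auto
  qed
  then show ?thesis
    by (auto simp: multisign_group_def sign_img_def intro!: restrict_ext)
qed

theorem theorem5p2:
  fixes n m :: nat and V :: "'v set" and \<sigma> :: "'v set \<Rightarrow> nat \<Rightarrow> int"
  assumes "n \<ge> 4" and "m \<ge> 1"
    and "multisigned_complete_graph V \<sigma> (multisign_group m)"
    and "card V = n"
  shows "(\<forall>g \<in> carrier (multisign_group m). g \<noteq> \<one>\<^bsub>multisign_group m\<^esub> \<longrightarrow>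
            ((\<forall>C. hamiltonian_cycle V (complete_edges V) C \<longrightarrow>
                multisign (multisign_group m) \<sigma> C = g) \<longleftrightarrow>
             (\<forall>T. graph_triangle V (complete_edges V) T \<longrightarrow>
                multisign (multisign_group m) \<sigma> T = g) \<and> odd n))
       \<and> ((\<forall>C. hamiltonian_cycle V (complete_edges V) C \<longrightarrow>
              multisign (multisign_group m) \<sigma> C = \<one>\<^bsub>multisign_group m\<^esub>) \<longleftrightarrow>
           ((\<exists>h \<in> carrier (multisign_group m). h \<noteq> \<one>\<^bsub>multisign_group m\<^esub> \<and>
               (\<forall>T. graph_triangle V (complete_edges V) T \<longrightarrow>
                  multisign (multisign_group m) \<sigma> T = h)) \<and> even n) \<or>
           (\<forall>T. graph_triangle V (complete_edges V) T \<longrightarrow>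
              multisign (multisign_group m) \<sigma> T = \<one>\<^bsub>multisign_group m\<^esub>))
       \<and> ((\<exists>C D. hamiltonian_cycle V (complete_edges V) C \<and>
              hamiltonian_cycle V (complete_edges V) D \<and>
              multisign (multisign_group m) \<sigma> C \<noteq> multisign (multisign_group m) \<sigma> D) \<longleftrightarrow>
           (\<exists>S T. graph_triangle V (complete_edges V) S \<and> graph_triangle V (complete_edges V) T \<and>
              multisign (multisign_group m) \<sigma> S \<noteq> multisign (multisign_group m) \<sigma> T))"
proof -
  interpret multisigned_complete "multisign_group m" V \<sigma>
    using assms(3) comm_group_multisign_group[of m] multisign_group_self_inverse[of _ m]
    by (simp add: multisigned_complete_def multisigned_complete_axioms_def)
  have "3 \<le> card V"
    using assms(1,4) by simp
  obtain T0 C0 where T0: "is_triangle T0" and C0: "is_hamiltonian C0"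
    using ex_triangle ex_hamiltonian \<open>3 \<le> card V\<close> by blast
  from \<open>3 \<le> card V\<close> show ?thesis
  proof (cases rule: triangle_hamiltonian_dichotomy)
    case (1 h)
    have tri: "(\<forall>T. is_triangle T \<longrightarrow> multisign (multisign_group m) \<sigma> T = g) \<longleftrightarrow> h = g" for g
      using 1(2) T0 by auto
    have ham: "(\<forall>C. is_hamiltonian C \<longrightarrow> multisign (multisign_group m) \<sigma> C = g)
        \<longleftrightarrow> (if even n then \<one>\<^bsub>multisign_group m\<^esub> else h) = g" for g
      using 1(1,3) C0 assms(4) by (auto simp: pow_parity)
    show ?thesis
      unfolding tri ham using 1 by auto
  next
    case (2 S T C D)
    then have "\<not> (\<forall>T. is_triangle T \<longrightarrow> multisign (multisign_group m) \<sigma> T = g)"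
      and "\<not> (\<forall>C. is_hamiltonian C \<longrightarrow> multisign (multisign_group m) \<sigma> C = g)" for g
      by auto
    then show ?thesis
      using 2 by blast
  qed
qed

end
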